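(* Let $n\ge 1$ and let $G$ be a subgroup of the symmetric group $\mathfrak{S}_n$. Then, in $\mathrm{WSym}$, $$\mathrm{Z}_G=\sum_{\pi}\#\mathrm{Stab}_G(w_\pi)\,M_\pi ,$$ where the sum is over all set partitions $\pi=\{\pi_1,\pi_2,\dots\}$ of $\{1,\dots,n\}$ and $w_\pi$ is any word $a_1\cdots a_n$ such that $a_i=a_j$ if and only if $i,j\in\pi_k$ for some $k$.
   Context: $\mathrm{WSym}$ (word symmetric functions) is the graded complex vector space $\bigoplus_{n\ge 0}\mathrm{WSym}_n$, where $\mathrm{WSym}_n$ has a basis $(\Phi^\pi)$ indexed by the set partitions $\pi$ of $\{1,\dots,n\}$ (it is an algebra for the shifted concatenation product, which is not needed here). For set partitions $\pi,\pi'$ of $\{1,\dots,n\}$, write $\pi\le\pi'$ if $\pi$ is finer than $\pi'$, i.e. each block of $\pi'$ is a union of blocks of $\pi$. The word monomial basis $(M_\pi)$ is the basis of $\mathrm{WSym}$ defined by $\Phi^\pi=\sum_{\pi\le\pi'}M_{\pi'}$. Equivalently, over an infinite alphabet $A$ of noncommuting letters, $\Phi^\pi$ is identified with the (formal, homogeneous of degree $n$) sum of all words $w_1\cdots w_n$ such that $w_i=w_j$ whenever $i,j$ are in the same block of $\pi$, and $M_\pi$ with the sum of all words $w_1\cdots w_n$ such that $w_i=w_j$ if and only if $i,j$ are in the same block of $\pi$. For a permutation $\sigma\in\mathfrak{S}_n$, its cycle support $\mathrm{cycle\_support}(\sigma)$ is the set partition of $\{1,\dots,n\}$ whose blocks are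 the supports of the cycles of $\sigma$ (fixed points included as singletons), and $\Phi^\sigma:=\Phi^{\mathrm{cycle\_support}(\sigma)}$. The cycle support polynomial of $G$ is $\mathrm{Z}_G:=\sum_{\sigma\in G}\Phi^\sigma$. The group $\mathfrak{S}_n$ acts on words of length $n$ by permuting positions: for $w=b_1\cdots b_n$, $w\sigma=b_{\sigma(1)}\cdots b_{\sigma(n)}$. The stabilizer is $\mathrm{Stab}_G(w)=\{\sigma\in G: w\sigma=w\}$. *)

theory Defs
  imports
    Complex_Main
    "HOL-Library.Disjoint_Sets"
    "HOL-Library.Poly_Mapping"
    "HOL-Combinatorics.Orbits"
    "HOL-Algebra.Sym_Groups"
begin

section \<open>Set partitions\<close>

text \<open>One type for the set partitions of all the sets \<open>{1..n}\<close>: \<open>n\<close> can be recovered from the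
  partition, so this is the disjoint union over \<open>n\<close>, and finitely supported functions on it form
  the direct sum of the graded components.\<close>

typedef set_partition = "{P :: nat set set. \<exists>n. partition_on {1..n} P}"
  morphisms blocks Abs_set_partition
  by (auto intro: partition_on_singletons)

definition set_partitions :: "nat \<Rightarrow> set_partition set" where
  "set_partitions n = {\<pi>. partition_on {1..n} (blocks \<pi>)}"

lemma blocks_Abs: "partition_on {1..n} P \<Longrightarrow> blocks (Abs_set_partition P) = P"
  by (rule Abs_set_partition_inverse) blast

lemma ex_set_partitions: "\<exists>n. \<pi> \<in> set_partitions n"
  using blocks[of \<pi>] by (auto simp: set_partitions_def)

lemma set_partitions_disjoint:
  assumes "\<pi> \<in> set_partitions m" "\<pi> \<in> set_partitions n"
  shows "m = n"
proof -
  have "{1..m} = {1..n}"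
    using assms partition_onD1 unfolding set_partitions_def by (metis mem_Collect_eq)
  then have "card {1..m} = card {1..n}" by (rule arg_cong)
  then show ?thesis by (simp only: card_atLeastAtMost diff_Suc_1)
qed

lemma finite_set_partitions: "finite (set_partitions n)"
proof (rule finite_imageD)
  show "finite (blocks ` set_partitions n)"
    by (rule finite_subset[OF _ finitely_many_partition_on[of "{1..n}"]])
       (auto simp: set_partitions_def)
  show "inj_on blocks (set_partitions n)"
    by (meson blocks_inject inj_onI)
qed

instantiation set_partition :: order
begin

definition less_eq_set_partition :: "set_partition \<Rightarrow> set_partition \<Rightarrow> bool" where
  "\<pi> \<le> \<pi>' \<longleftrightarrow> (\<exists>n. refines {1..n} (blocks \<pi>) (blocks \<pi>'))"

definition less_set_partition :: "set_partition \<Rightarrow> set_partition \<Rightarrow> bool" where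
  "\<pi> < \<pi>' \<longleftrightarrow> \<pi> \<le> \<pi>' \<and> \<not> \<pi>' \<le> (\<pi> :: set_partition)"

instance
proof
  have deg: "m = n" if "refines {1..m} P Q" "refines {1..n} Q R" for m n and P Q R :: "nat set set"
  proof -
    have "{1..m} = {1..n}"
      using that partition_onD1 unfolding refines_def by metis
    then have "card {1..m} = card {1..n}" by (rule arg_cong)
    then show ?thesis by (simp only: card_atLeastAtMost diff_Suc_1)
  qed
  fix x y z :: set_partition
  show "x \<le> x"
    using blocks[of x] by (auto simp: less_eq_set_partition_def intro: refines_refl)
  show "x \<le> z" if "x \<le> y" "y \<le> z"
    using that deg unfolding less_eq_set_partition_def by (metis refines_trans)
  show "x = y" if "x \<le> y" "y \<le> x"
    using that deg unfolding less_eq_set_partition_def by (metis refines_asym blocks_inject)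
qed (simp add: less_set_partition_def)

end

lemma le_set_partition_degree:
  assumes "\<pi> \<le> \<pi>'"
  shows "\<pi> \<in> set_partitions n \<longleftrightarrow> \<pi>' \<in> set_partitions n"
proof -
  obtain m where "\<pi> \<in> set_partitions m" "\<pi>' \<in> set_partitions m"
    using assms by (auto simp: less_eq_set_partition_def refines_def set_partitions_def)
  then show ?thesis using set_partitions_disjoint by blast
qed

lemma le_set_partition_iff:
  assumes "\<pi> \<in> set_partitions n" "\<pi>' \<in> set_partitions n"
  shows "\<pi> \<le> \<pi>' \<longleftrightarrow> (\<forall>B\<in>blocks \<pi>'. \<exists>C\<subseteq>blocks \<pi>. B = \<Union>C)"
proof
  assume "\<pi> \<le> \<pi>'"
  then obtain m where r: "refines {1..m} (blocks \<pi>) (blocks \<pi>')"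
    by (auto simp: less_eq_set_partition_def)
  show "\<forall>B\<in>blocks \<pi>'. \<exists>C\<subseteq>blocks \<pi>. B = \<Union>C"
  proof
    fix B assume B: "B \<in> blocks \<pi>'"
    have "B = \<Union>{X\<in>blocks \<pi>. X \<subseteq> B}"
    proof (intro equalityI subsetI)
      fix x assume x: "x \<in> B"
      then have "x \<in> {1..m}"
        using r B unfolding refines_def partition_on_def by blast
      then obtain X where X: "X \<in> blocks \<pi>" "x \<in> X"
        using r unfolding refines_def partition_on_def by blast
      then obtain Y where Y: "Y \<in> blocks \<pi>'" "X \<subseteq> Y"
        using r by (auto simp: refines_def)
      have "disjoint (blocks \<pi>')"
        using r partition_onD2 unfolding refines_def by blast
      then have "Y = B"
        using disjointD[of _ Y B] Y X x B by blast
      then show "x \<in> \<Union>{X\<in>blocks \<pi>. X \<subseteq> B}" using X Y by blast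
    qed auto
    then show "\<exists>C\<subseteq>blocks \<pi>. B = \<Union>C"
      by (intro exI[of _ "{X\<in>blocks \<pi>. X \<subseteq> B}"]) simp
  qed
next
  assume u: "\<forall>B\<in>blocks \<pi>'. \<exists>C\<subseteq>blocks \<pi>. B = \<Union>C"
  have "\<exists>Y\<in>blocks \<pi>'. X \<subseteq> Y" if X: "X \<in> blocks \<pi>" for X
  proof -
    obtain x where x: "x \<in> X"
      using assms X by (force simp: set_partitions_def partition_on_def)
    then have "x \<in> \<Union>(blocks \<pi>')"
      using assms X by (auto simp: set_partitions_def partition_on_def)
    then obtain Y where Y: "Y \<in> blocks \<pi>'" "x \<in> Y" by blast
    then obtain C where C: "C \<subseteq> blocks \<pi>" "Y = \<Union>C" using u by blast
    then obtain X' where X': "X' \<in> C" "x \<in> X'" using Y by blast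
    have "disjoint (blocks \<pi>)"
      using assms(1) partition_onD2 unfolding set_partitions_def by blast
    then have "X' = X"
      using disjointD[of _ X' X] X X' x C by blast
    then show ?thesis using X' C Y by blast
  qed
  then show "\<pi> \<le> \<pi>'"
    using assms unfolding less_eq_set_partition_def refines_def set_partitions_def by blast
qed

lemma finite_coarser: "finite {\<pi>'. \<pi> \<le> (\<pi>' :: set_partition)}"
proof -
  obtain n where "\<pi> \<in> set_partitions n" using ex_set_partitions by blast
  then show ?thesis
    using le_set_partition_degree
    by (intro finite_subset[OF _ finite_set_partitions[of n]]) blast
qed

lemma wf_coarser: "wf {(\<pi>', \<pi> :: set_partition). \<pi> < \<pi>'}"
proof (rule wf_subset[OF wf_measure[of "\<lambda>\<pi>. card {\<pi>'. \<pi> \<le> \<pi>'}"]], clarsimp)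
  fix x y :: set_partition assume "y < x"
  then have "{z. x \<le> z} \<subset> {z. y \<le> z}"
    by (auto simp: psubset_eq set_eq_iff) (use order.strict_trans1 in blast)+
  then show "card {z. x \<le> z} < card {z. y \<le> z}"
    by (rule psubset_card_mono[OF finite_coarser])
qed


section \<open>Word symmetric functions\<close>

type_synonym wsym = "set_partition \<Rightarrow>\<^sub>0 complex"

definition wscale :: "complex \<Rightarrow> wsym \<Rightarrow> wsym" where
  "wscale c f = Poly_Mapping.map ((*) c) f"

lemma lookup_wscale: "Poly_Mapping.lookup (wscale c f) \<pi> = c * Poly_Mapping.lookup f \<pi>"
  by (simp add: wscale_def Poly_Mapping.map.rep_eq when_def)

interpretation WSym: vector_space wscale
  by standard (auto intro!: poly_mapping_eqI simp: lookup_wscale lookup_add algebra_simps)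

definition Phi :: "set_partition \<Rightarrow> wsym" where
  "Phi \<pi> = Poly_Mapping.single \<pi> 1"

definition WSym_hom :: "nat \<Rightarrow> wsym set" where
  "WSym_hom n = WSym.span (Phi ` set_partitions n)"

text \<open>The word monomial basis is the unique family satisfying its defining relation; existence,
  uniqueness and the basis property are proved below.\<close>

definition Mon :: "set_partition \<Rightarrow> wsym" where
  "Mon = (THE M. \<forall>\<pi>. Phi \<pi> = (\<Sum>\<pi>' | \<pi> \<le> \<pi>'. M \<pi>'))"

lemma coarser_sum:
  fixes M :: "set_partition \<Rightarrow> wsym"
  shows "(\<Sum>\<pi>' | \<pi> \<le> \<pi>'. M \<pi>') = M \<pi> + (\<Sum>\<pi>' | \<pi> < \<pi>'. M \<pi>')"
proof -
  have "{\<pi>'. \<pi> \<le> \<pi>'} = insert \<pi> {\<pi>'. \<pi> < \<pi>'}" by auto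
  moreover have "finite {\<pi>'. \<pi> < \<pi>'}"
    by (rule finite_subset[OF _ finite_coarser[of \<pi>]]) auto
  ultimately show ?thesis by simp
qed

lemma ex1_Mon: "\<exists>!M. \<forall>\<pi>. Phi \<pi> = (\<Sum>\<pi>' | \<pi> \<le> \<pi>'. M \<pi>')"
proof (rule ex_ex1I)
  define M where "M = wfrec {(\<pi>', \<pi>). \<pi> < \<pi>'} (\<lambda>M \<pi>. Phi \<pi> - (\<Sum>\<pi>' | \<pi> < \<pi>'. M \<pi>'))"
  have "M \<pi> = Phi \<pi> - (\<Sum>\<pi>' | \<pi> < \<pi>'. M \<pi>')" for \<pi>
  proof -
    have "M \<pi> = Phi \<pi> - (\<Sum>\<pi>' | \<pi> < \<pi>'. cut M {(\<pi>', \<pi>). \<pi> < \<pi>'} \<pi> \<pi>')"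
      unfolding M_def by (subst wfrec[OF wf_coarser]) simp
    also have "\<dots> = Phi \<pi> - (\<Sum>\<pi>' | \<pi> < \<pi>'. M \<pi>')"
      by (intro arg_cong2[where f = "(-)"] sum.cong) (auto simp: cut_apply)
    finally show ?thesis .
  qed
  then have "\<forall>\<pi>. Phi \<pi> = (\<Sum>\<pi>' | \<pi> \<le> \<pi>'. M \<pi>')"
    unfolding coarser_sum by (metis diff_add_cancel)
  then show "\<exists>M. \<forall>\<pi>. Phi \<pi> = (\<Sum>\<pi>' | \<pi> \<le> \<pi>'. M \<pi>')" by blast
next
  fix M N
  assume M: "\<forall>\<pi>. Phi \<pi> = (\<Sum>\<pi>' | \<pi> \<le> \<pi>'. M \<pi>')" and N: "\<forall>\<pi>. Phi \<pi> = (\<Sum>\<pi>' | \<pi> \<le> \<pi>'. N \<pi>')"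
  have "M \<pi> = N \<pi>" for \<pi>
  proof (induction \<pi> rule: wf_induct_rule[OF wf_coarser])
    case (1 \<pi>)
    have "M \<pi> + (\<Sum>\<pi>' | \<pi> < \<pi>'. M \<pi>') = N \<pi> + (\<Sum>\<pi>' | \<pi> < \<pi>'. N \<pi>')"
      using M N by (metis coarser_sum)
    moreover have "(\<Sum>\<pi>' | \<pi> < \<pi>'. M \<pi>') = (\<Sum>\<pi>' | \<pi> < \<pi>'. N \<pi>')"
      using 1 by (intro sum.cong) auto
    ultimately show ?case by simp
  qed
  then show "M = N" by blast
qed

lemma Phi_eq_sum_Mon: "Phi \<pi> = (\<Sum>\<pi>' | \<pi> \<le> \<pi>'. Mon \<pi>')"
  using theI'[OF ex1_Mon] unfolding Mon_def by blast

lemma Mon_rec: "Mon \<pi> = Phi \<pi> - (\<Sum>\<pi>' | \<pi> < \<pi>'. Mon \<pi>')"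
  using Phi_eq_sum_Mon[of \<pi>] by (simp add: coarser_sum)

lemma lookup_Mon: "Poly_Mapping.lookup (Mon \<pi>) \<rho> = (if \<rho> = \<pi> then 1 else 0)" if "\<not> \<pi> < \<rho>"
  using that
proof (induction \<pi> rule: wf_induct_rule[OF wf_coarser])
  case (1 \<pi>)
  have "Poly_Mapping.lookup (Mon \<pi>') \<rho> = 0" if "\<pi> < \<pi>'" for \<pi>'
    using 1 that by (auto dest: order.strict_trans)
  then show ?case
    by (subst Mon_rec) (auto simp: lookup_minus Phi_def lookup_single lookup_sum when_def)
qed

lemma span_Phi: "WSym.span (range Phi) = UNIV"
proof -
  have "f \<in> WSym.span (range Phi)" for f
  proof -
    have "f = (\<Sum>\<pi>\<in>Poly_Mapping.keys f. wscale (Poly_Mapping.lookup f \<pi>) (Phi \<pi>))"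
      by (intro poly_mapping_eqI)
         (auto simp: lookup_sum lookup_wscale Phi_def lookup_single when_def in_keys_iff
           if_distrib[of "(*) _"] sum.delta' cong: if_cong)
    also have "\<dots> \<in> WSym.span (range Phi)"
      by (intro WSym.span_sum WSym.span_scale WSym.span_base) auto
    finally show ?thesis .
  qed
  then show ?thesis by blast
qed

lemma span_Mon: "WSym.span (range Mon) = UNIV"
proof -
  have "Phi \<pi> \<in> WSym.span (range Mon)" for \<pi>
    unfolding Phi_eq_sum_Mon by (intro WSym.span_sum WSym.span_base) auto
  then have "WSym.span (range Phi) \<subseteq> WSym.span (range Mon)"
    by (intro WSym.span_minimal WSym.subspace_span) auto
  then show ?thesis using span_Phi by auto
qed

lemma inj_Mon: "inj Mon"
proof (rule injI, rule ccontr)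
  fix \<pi> \<rho> assume eq: "Mon \<pi> = Mon \<rho>" and "\<pi> \<noteq> \<rho>"
  then have "\<not> \<pi> < \<rho> \<or> \<not> \<rho> < \<pi>" by auto
  then show False
    using lookup_Mon[of \<pi> \<rho>] lookup_Mon[of \<rho> \<pi>] lookup_Mon[of \<pi> \<pi>] lookup_Mon[of \<rho> \<rho>] eq \<open>\<pi> \<noteq> \<rho>\<close>
    by (auto split: if_splits)
qed

lemma independent_Mon: "\<not> WSym.dependent (range Mon)"
proof
  assume "WSym.dependent (range Mon)"
  then obtain T u where T: "finite T" "T \<subseteq> range Mon" and s: "(\<Sum>v\<in>T. wscale (u v) v) = 0"
    and nz: "\<exists>v\<in>T. u v \<noteq> 0"
    unfolding WSym.dependent_explicit by blast
  define S where "S = {\<pi>. Mon \<pi> \<in> T \<and> u (Mon \<pi>) \<noteq> 0}"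
  have "finite S"
    by (rule finite_subset[of _ "Mon -` T"])
       (use T inj_Mon in \<open>auto simp: S_def intro: finite_vimageI\<close>)
  moreover have "S \<noteq> {}" using nz T by (auto simp: S_def)
  ultimately obtain \<rho> where \<rho>: "\<rho> \<in> S" and min: "\<And>\<pi>. \<pi> \<in> S \<Longrightarrow> \<pi> \<le> \<rho> \<Longrightarrow> \<rho> = \<pi>"
    using finite_has_minimal[of S] by auto
  have "(\<Sum>v\<in>T. u v * Poly_Mapping.lookup v \<rho>) = Poly_Mapping.lookup (\<Sum>v\<in>T. wscale (u v) v) \<rho>"
    by (simp add: lookup_sum lookup_wscale)
  then have "(\<Sum>v\<in>T. u v * Poly_Mapping.lookup v \<rho>) = 0" using s by simp
  moreover have "(\<Sum>v\<in>T. u v * Poly_Mapping.lookup v \<rho>) = (\<Sum>v\<in>T. if v = Mon \<rho> then u v else 0)"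
  proof (rule sum.cong[OF refl])
    fix v assume v: "v \<in> T"
    then obtain \<pi> where \<pi>: "v = Mon \<pi>" using T by blast
    show "u v * Poly_Mapping.lookup v \<rho> = (if v = Mon \<rho> then u v else 0)"
    proof (cases "u v = 0")
      case False
      then have "\<pi> \<in> S" using v \<pi> by (simp add: S_def)
      then have "\<not> \<pi> < \<rho>" using min[of \<pi>] by (metis less_imp_le order_less_irrefl)
      then show ?thesis using \<pi> inj_Mon by (auto simp: lookup_Mon inj_eq)
    qed auto
  qed
  moreover have "\<dots> = u (Mon \<rho>)" using T \<rho> by (auto simp: S_def)
  ultimately show False using \<rho> by (simp add: S_def)
qed


section \<open>The cycle support polynomial\<close>

definition cycle_support :: "nat \<Rightarrow> (nat \<Rightarrow> nat) \<Rightarrow> set_partition" where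
  "cycle_support n \<sigma> = Abs_set_partition (orbit \<sigma> ` {1..n})"

lemma partition_on_orbits:
  fixes n :: nat
  assumes "\<sigma> permutes {1..n}"
  shows "partition_on {1..n} (orbit \<sigma> ` {1..n})"
proof -
  have p: "permutation \<sigma>" using assms by (rule permutes_imp_permutation[OF finite_atLeastAtMost])
  have self: "x \<in> orbit \<sigma> x" for x by (rule permutation_self_in_orbit[OF p])
  have sub: "orbit \<sigma> x \<subseteq> {1..n}" if "x \<in> {1..n}" for x
  proof
    fix y assume "y \<in> orbit \<sigma> x"
    then show "y \<in> {1..n}"
      by induction (use that permutes_in_image[OF assms] in blast)+
  qed
  have le: "orbit \<sigma> x \<subseteq> orbit \<sigma> y" if "z \<in> orbit \<sigma> x" "z \<in> orbit \<sigma> y" for x y z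
  proof
    fix t assume "t \<in> orbit \<sigma> x"
    then have "t \<in> orbit \<sigma> z"
      using orbit_trans[OF _ orbit_swap[OF self that(1)]] by blast
    then show "t \<in> orbit \<sigma> y" by (rule orbit_trans[OF _ that(2)])
  qed
  show ?thesis
  proof (rule partition_onI)
    show "\<Union>(orbit \<sigma> ` {1..n}) = {1..n}" using self sub by blast
    show "{} \<notin> orbit \<sigma> ` {1..n}"
      using self by auto
    show "disjnt p q" if "p \<in> orbit \<sigma> ` {1..n}" "q \<in> orbit \<sigma> ` {1..n}" "p \<noteq> q" for p q
      using that le unfolding disjnt_def by blast
  qed
qed

lemma blocks_cycle_support:
  "\<sigma> permutes {1..n} \<Longrightarrow> blocks (cycle_support n \<sigma>) = orbit \<sigma> ` {1..n}"
  unfolding cycle_support_def by (rule blocks_Abs[OF partition_on_orbits])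

definition cycle_support_poly :: "nat \<Rightarrow> (nat \<Rightarrow> nat) set \<Rightarrow> wsym" where
  "cycle_support_poly n G = (\<Sum>\<sigma>\<in>G. Phi (cycle_support n \<sigma>))"


section \<open>Words\<close>

text \<open>Positions in words are numbered from \<open>1\<close>, as are the points moved by permutations.\<close>

definition letter :: "'a list \<Rightarrow> nat \<Rightarrow> 'a" where
  "letter w i = w ! (i - 1)"

definition word_act :: "'a list \<Rightarrow> (nat \<Rightarrow> nat) \<Rightarrow> 'a list" where
  "word_act w \<sigma> = map (\<lambda>i. letter w (\<sigma> i)) [1..<Suc (length w)]"

definition word_stab :: "(nat \<Rightarrow> nat) set \<Rightarrow> 'a list \<Rightarrow> (nat \<Rightarrow> nat) set" where
  "word_stab G w = {\<sigma>\<in>G. word_act w \<sigma> = w}"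

definition word_of_partition :: "nat \<Rightarrow> set_partition \<Rightarrow> 'a list \<Rightarrow> bool" where
  "word_of_partition n \<pi> w \<longleftrightarrow> length w = n \<and>
     (\<forall>i\<in>{1..n}. \<forall>j\<in>{1..n}. letter w i = letter w j \<longleftrightarrow> (\<exists>B\<in>blocks \<pi>. i \<in> B \<and> j \<in> B))"

end

theory Submission
  imports Defs
begin

text \<open>
  Expanding each \<open>\<Phi>\<close> in the monomial basis turns \<open>Z\<^sub>G\<close> into a double sum over the pairs of a
  permutation \<open>\<sigma>\<close> in \<open>G\<close> and a partition \<open>\<pi>\<close> coarser than the cycle support of \<open>\<sigma>\<close>. Counted by
  \<open>\<pi>\<close> first, the coefficient of \<open>M\<^sub>\<pi>\<close> is the number of \<open>\<sigma>\<close> whose cycles all lie inside blocks of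
  \<open>\<pi>\<close>. A permutation of positions fixes a word exactly when the letters are constant along its
  cycles; in \<open>w\<^sub>\<pi>\<close> two positions carry the same letter exactly when they share a block of \<open>\<pi>\<close>, so
  these \<open>\<sigma>\<close> are the stabilizer of \<open>w\<^sub>\<pi>\<close> (\<open>word_act_fixes_iff_cycle_support_le\<close>).
\<close>

lemma cycle_support_in_set_partitions:
  "\<sigma> permutes {1..n} \<Longrightarrow> cycle_support n \<sigma> \<in> set_partitions n"
  by (simp only: set_partitions_def mem_Collect_eq blocks_cycle_support partition_on_orbits)

lemma word_act_fixes_iff:
  "word_act w \<sigma> = w \<longleftrightarrow> (\<forall>i\<in>{1..length w}. letter w (\<sigma> i) = letter w i)"
proof -
  have "word_act w \<sigma> = w \<longleftrightarrow> (\<forall>k<length w. letter w (\<sigma> (Suc k)) = letter w (Suc k))"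
  proof -
    have len: "length (word_act w \<sigma>) = length w"
      by (simp only: word_act_def length_map length_upt diff_Suc_1)
    have nth: "word_act w \<sigma> ! k = letter w (\<sigma> (Suc k))" if "k < length w" for k
      using that by (simp add: word_act_def del: upt_Suc)
    show ?thesis
      by (simp only: list_eq_iff_nth_eq len nth simp_thms letter_def[of w "Suc _"] diff_Suc_1
          cong: imp_cong)
  qed
  also have "\<dots> \<longleftrightarrow> (\<forall>i\<in>Suc ` {..<length w}. letter w (\<sigma> i) = letter w i)"
    by (simp only: ball_simps) (simp only: Ball_def lessThan_iff)
  finally show ?thesis
    by (simp only: image_Suc_lessThan)
qed

lemma constant_on_orbit:
  assumes "\<sigma> permutes A" "x \<in> A" "\<And>i. i \<in> A \<Longrightarrow> f (\<sigma> i) = f i" "y \<in> orbit \<sigma> x"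
  shows "y \<in> A \<and> f y = f x"
  using assms(4)
proof induction
  case base
  then show ?case using assms(2,3) permutes_in_image[OF assms(1)] by simp
next
  case (step y)
  then show ?case using assms(3) permutes_in_image[OF assms(1)] by simp
qed

lemma cycle_support_le_iff:
  assumes \<sigma>: "\<sigma> permutes {1..n}" and \<pi>: "\<pi> \<in> set_partitions n"
  shows "cycle_support n \<sigma> \<le> \<pi> \<longleftrightarrow> (\<forall>i\<in>{1..n}. \<exists>B\<in>blocks \<pi>. orbit \<sigma> i \<subseteq> B)"
proof
  assume "cycle_support n \<sigma> \<le> \<pi>"
  then show "\<forall>i\<in>{1..n}. \<exists>B\<in>blocks \<pi>. orbit \<sigma> i \<subseteq> B"
    unfolding less_eq_set_partition_def refines_def blocks_cycle_support[OF \<sigma>] by blast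
next
  assume "\<forall>i\<in>{1..n}. \<exists>B\<in>blocks \<pi>. orbit \<sigma> i \<subseteq> B"
  then have "refines {1..n} (blocks (cycle_support n \<sigma>)) (blocks \<pi>)"
    using \<pi> partition_on_orbits[OF \<sigma>]
    unfolding refines_def blocks_cycle_support[OF \<sigma>] set_partitions_def by blast
  then show "cycle_support n \<sigma> \<le> \<pi>"
    unfolding less_eq_set_partition_def by blast
qed

text \<open>A permutation fixes \<open>w\<^sub>\<pi>\<close> iff it moves every position to one with the same letter, that is, to
  one in the same block; iterating this along a cycle keeps the whole cycle inside that block.\<close>

lemma word_act_fixes_iff_cycle_support_le:
  assumes \<sigma>: "\<sigma> permutes {1..n}" and \<pi>: "\<pi> \<in> set_partitions n"
    and w: "word_of_partition n \<pi> w"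
  shows "word_act w \<sigma> = w \<longleftrightarrow> cycle_support n \<sigma> \<le> \<pi>"
proof -
  have same: "letter w i = letter w j \<longleftrightarrow> (\<exists>B\<in>blocks \<pi>. i \<in> B \<and> j \<in> B)"
    if "i \<in> {1..n}" "j \<in> {1..n}" for i j
    using w that by (simp only: word_of_partition_def)
  have len: "length w = n" using w by (simp only: word_of_partition_def)
  have part: "partition_on {1..n} (blocks \<pi>)" using \<pi> by (simp add: set_partitions_def)
  have "(\<forall>i\<in>{1..n}. letter w (\<sigma> i) = letter w i)
    \<longleftrightarrow> (\<forall>i\<in>{1..n}. \<exists>B\<in>blocks \<pi>. orbit \<sigma> i \<subseteq> B)"
  proof (intro iffI ballI)
    fix i assume fixes_letters: "\<forall>i\<in>{1..n}. letter w (\<sigma> i) = letter w i" and i: "i \<in> {1..n}"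
    obtain B where B: "B \<in> blocks \<pi>" "i \<in> B"
      using part i unfolding partition_on_def by blast
    have "orbit \<sigma> i \<subseteq> B"
    proof
      fix j assume "j \<in> orbit \<sigma> i"
      then have "j \<in> {1..n} \<and> letter w j = letter w i"
        using fixes_letters by (intro constant_on_orbit[OF \<sigma> i]) auto
      then have "\<exists>C\<in>blocks \<pi>. j \<in> C \<and> i \<in> C"
        by (subst same[symmetric]) (use i in auto)
      then obtain C where C: "C \<in> blocks \<pi>" "j \<in> C" "i \<in> C"
        by blast
      then have "C = B"
        using disjointD[OF partition_onD2[OF part]] B by blast
      then show "j \<in> B" using C by simp
    qed
    then show "\<exists>B\<in>blocks \<pi>. orbit \<sigma> i \<subseteq> B" using B by blast
  next
    fix i assume "\<forall>i\<in>{1..n}. \<exists>B\<in>blocks \<pi>. orbit \<sigma> i \<subseteq> B" and i: "i \<in> {1..n}"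
    then obtain B where B: "B \<in> blocks \<pi>" "orbit \<sigma> i \<subseteq> B" by blast
    have "permutation \<sigma>" by (rule permutes_imp_permutation[OF finite_atLeastAtMost \<sigma>])
    then have "i \<in> orbit \<sigma> i" by (rule permutation_self_in_orbit)
    moreover have "\<sigma> i \<in> orbit \<sigma> i" by (rule orbit.base)
    moreover have "\<sigma> i \<in> {1..n}" using i permutes_in_image[OF \<sigma>] by blast
    ultimately show "letter w (\<sigma> i) = letter w i"
      using i B by (subst same) auto
  qed
  then show ?thesis
    by (simp only: word_act_fixes_iff len cycle_support_le_iff[OF \<sigma> \<pi>])
qed

theorem theorem4p3:
  fixes n :: nat and G :: "(nat \<Rightarrow> nat) set" and w :: "set_partition \<Rightarrow> 'a list"
  assumes "n \<ge> 1"
    and "subgroup G (sym_group n)"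
    and "\<And>\<pi>. \<pi> \<in> set_partitions n \<Longrightarrow> word_of_partition n \<pi> (w \<pi>)"
  shows "cycle_support_poly n G =
    (\<Sum>\<pi>\<in>set_partitions n. wscale (of_nat (card (word_stab G (w \<pi>)))) (Mon \<pi>))"
proof -
  have perm: "\<sigma> permutes {1..n}" if "\<sigma> \<in> G" for \<sigma>
    using subgroup.subset[OF assms(2)] that by (auto simp: sym_group_def)
  have fin: "finite G"
    by (rule finite_subset[OF _ finite_permutations[of "{1..n}"]]) (use perm in auto)
  have coarser: "{\<pi>. cycle_support n \<sigma> \<le> \<pi>} = {\<pi>\<in>set_partitions n. cycle_support n \<sigma> \<le> \<pi>}"
    if "\<sigma> \<in> G" for \<sigma>
    using le_set_partition_degree cycle_support_in_set_partitions[OF perm[OF that]] by blast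
  have stab: "{\<sigma>\<in>G. cycle_support n \<sigma> \<le> \<pi>} = word_stab G (w \<pi>)" if "\<pi> \<in> set_partitions n" for \<pi>
    using word_act_fixes_iff_cycle_support_le[OF perm that assms(3)[OF that]]
    unfolding word_stab_def by (intro Collect_cong conj_cong refl) simp
  have "cycle_support_poly n G
      = (\<Sum>\<sigma>\<in>G. \<Sum>\<pi> | \<pi> \<in> set_partitions n \<and> cycle_support n \<sigma> \<le> \<pi>. Mon \<pi>)"
    unfolding cycle_support_poly_def Phi_eq_sum_Mon by (intro sum.cong refl coarser)
  also have "\<dots> = (\<Sum>\<pi>\<in>set_partitions n. \<Sum>\<sigma> | \<sigma> \<in> G \<and> cycle_support n \<sigma> \<le> \<pi>. Mon \<pi>)"
    by (rule sum.swap_restrict[OF fin finite_set_partitions])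
  also have "\<dots> = (\<Sum>\<pi>\<in>set_partitions n. wscale (of_nat (card (word_stab G (w \<pi>)))) (Mon \<pi>))"
    by (intro sum.cong refl) (simp only: stab WSym.sum_constant_scale)
  finally show ?thesis .
qed

end
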